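(* Consider the noisy simple harmonic urn $(\tilde X_n,\tilde Y_n)_{n\in\mathbb Z_+}$ with noise $\kappa$ satisfying $\mathbb P(\kappa=1)=1$ (equivalently, the leaky simple harmonic urn up to the time $\tau$). Let $\tau=\min\{n\in\mathbb Z_+:|\tilde X_n|+|\tilde Y_n|=1\}$, for $n\in\mathbb N$ let $T_n$ be the area of the triangle with vertices $(0,0)$, $(\tilde X_{n-1},\tilde Y_{n-1})$ and $(\tilde X_n,\tilde Y_n)$, and let $A=\sum_{n=1}^{\tau}T_n$. Then $\mathbb E[A]=\infty$.
   Context: $\mathbb Z_+=\{0,1,2,\dots\}$, $\mathbb N=\{1,2,\dots\}$, and $\operatorname{sgn}(x)=-1,0,1$ according as $x<0$, $x=0$, $x>0$. The noisy simple harmonic urn with $\mathbb P(\kappa=1)=1$ is the Markov chain $(\tilde X_n,\tilde Y_n)_{n\in\mathbb Z_+}$ on $\mathbb Z^2\setminus\{(0,0)\}$ with $(\tilde X_0,\tilde Y_0)=(z_0,1)$, $z_0\in\mathbb N$, and the following transition law. Given $(\tilde X_n,\tilde Y_n)=(x,y)$ with $xy\neq0$, $$(\tilde X_{n+1},\tilde Y_{n+1})=\begin{cases}(x,y+\operatorname{sgn}(x)) & \text{with probability } \frac{|x|}{|x|+|y|},\\ (x-\operatorname{sgn}(y),y) & \text{with probability } \frac{|y|}{|x|+|y|};\end{cases}$$ if $x=0$, then $(\tilde X_{n+1},\tilde Y_{n+1})=(-\operatorname{sgn}(y),\ \operatorname{sgn}(y)\max(1,|y|-1))$; if $y=0$,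 then $(\tilde X_{n+1},\tilde Y_{n+1})=(\operatorname{sgn}(x)\max(1,|x|-1),\ \operatorname{sgn}(x))$. The leaky simple harmonic urn $(X'_n,Y'_n)$ has the same starting point $(z_0,1)$ and the same transitions when $xy\ne0$, while from $(0,y)$ it moves to $(-\operatorname{sgn}(y),y-\operatorname{sgn}(y))$ and from $(x,0)$ to $(x-\operatorname{sgn}(x),\operatorname{sgn}(x))$; the two processes coincide in law up to the first time $\tau$ at which $|x|+|y|=1$. *)

theory Defs
  imports "HOL-Probability.Probability" "HOL-Library.Extended_Nat"
begin

text \<open>Discrete-time Markov chain on a countable state space \<open>S\<close>, with transition law \<open>K\<close> and
  almost sure starting state \<open>s0\<close>.\<close>

definition markov_chain ::
  "'a measure \<Rightarrow> 's set \<Rightarrow> ('s \<Rightarrow> 's pmf) \<Rightarrow> 's \<Rightarrow> (nat \<Rightarrow> 'a \<Rightarrow> 's) \<Rightarrow> bool" where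
  "markov_chain M S K s0 Z \<longleftrightarrow>
     (\<forall>n. Z n \<in> measurable M (count_space S)) \<and>
     (AE \<omega> in M. Z 0 \<omega> = s0) \<and>
     (\<forall>n s t. \<P>(\<omega> in M. \<forall>i\<le>n. Z i \<omega> = s i) > 0 \<longrightarrow>
        \<P>(\<omega> in M. Z (Suc n) \<omega> = t \<bar> \<forall>i\<le>n. Z i \<omega> = s i) = pmf (K (s n)) t)"

text \<open>The noise is constantly 1. The origin is not a state; the value of the function there
  plays no role.\<close>

definition noisy_urn_step :: "int \<times> int \<Rightarrow> (int \<times> int) pmf" where
  "noisy_urn_step = (\<lambda>(x, y).
     if x = 0 then return_pmf (- sgn y, sgn y * max 1 (\<bar>y\<bar> - 1))
     else if y = 0 then return_pmf (sgn x * max 1 (\<bar>x\<bar> - 1), sgn x)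
     else map_pmf (\<lambda>b. if b then (x, y + sgn x) else (x - sgn y, y))
            (bernoulli_pmf (real_of_int \<bar>x\<bar> / real_of_int (\<bar>x\<bar> + \<bar>y\<bar>))))"

definition noisy_urn ::
  "'a measure \<Rightarrow> nat \<Rightarrow> (nat \<Rightarrow> 'a \<Rightarrow> int \<times> int) \<Rightarrow> bool" where
  "noisy_urn M z0 Z \<longleftrightarrow> markov_chain M (- {(0, 0)}) noisy_urn_step (int z0, 1) Z"

text \<open>The infimum of the empty set is \<open>\<infinity>\<close>.\<close>

definition urn_tau :: "(nat \<Rightarrow> 'a \<Rightarrow> int \<times> int) \<Rightarrow> 'a \<Rightarrow> enat" where
  "urn_tau Z \<omega> = Inf {enat n | n. \<bar>fst (Z n \<omega>)\<bar> + \<bar>snd (Z n \<omega>)\<bar> = 1}"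

definition plane_point :: "int \<times> int \<Rightarrow> real ^ 2" where
  "plane_point p = vector [real_of_int (fst p), real_of_int (snd p)]"

definition urn_triangle :: "(nat \<Rightarrow> 'a \<Rightarrow> int \<times> int) \<Rightarrow> nat \<Rightarrow> 'a \<Rightarrow> real" where
  "urn_triangle Z n \<omega> =
     measure lebesgue (convex hull {0, plane_point (Z (n - 1) \<omega>), plane_point (Z n \<omega>)})"

text \<open>The summand with index \<open>k\<close> is the triangle with index \<open>n = Suc k\<close>, so that the sum runs
  over \<open>1 \<le> n \<le> \<tau>\<close>, also if \<open>\<tau> = \<infinity>\<close>.\<close>

definition urn_area :: "(nat \<Rightarrow> 'a \<Rightarrow> int \<times> int) \<Rightarrow> 'a \<Rightarrow> ennreal" where
  "urn_area Z \<omega> =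
     (\<Sum>k. if enat (Suc k) \<le> urn_tau Z \<omega> then ennreal (urn_triangle Z (Suc k) \<omega>) else 0)"

end

theory Submission
  imports Defs
begin

text \<open>Let \<open>F\<close> be \<open>x\<^sup>2 + y\<^sup>2\<close> plus the linear term \<open>\<bar>x\<bar> - \<bar>y\<bar>\<close>, \<open>\<bar>y\<bar> - \<bar>x\<bar>\<close> or \<open>- \<bar>x\<bar> - \<bar>y\<bar>\<close>, according as
  \<open>x y\<close> is positive, negative or zero. It is an exact martingale up to \<open>\<tau>\<close> and vanishes at \<open>\<tau>\<close>, so
  \<open>E[F(Z\<^sub>n); n < \<tau>]\<close> equals \<open>F(z\<^sub>0, 1) > 0\<close> for every \<open>n\<close>. With \<open>r = \<bar>x\<bar> + \<bar>y\<bar>\<close>, the mean area of a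
  step is at least \<open>r / 4\<close> and the drift of \<open>F\<close> to the power \<open>3/2\<close> is at most \<open>4 r\<close>. If \<open>E[A]\<close> were
  finite, then \<open>E[r(Z\<^sub>n); n < \<tau>]\<close> would be summable in \<open>n\<close>, hence \<open>F\<close> to the power \<open>3/2\<close> would have
  bounded expectation before \<open>\<tau>\<close>. Interpolating \<open>F\<close> between this power and \<open>r\<close> would
  give \<open>E[F(Z\<^sub>n); n < \<tau>] \<rightarrow> 0\<close>, a contradiction.\<close>

section \<open>One-step expectations along a Markov chain\<close>

text \<open>Split \<open>f (X \<omega>)\<close> over the level sets of \<open>X\<close> and exchange
  the countable sum with the integral.\<close>

lemma nn_integral_countable_valued:
  fixes X :: "'a \<Rightarrow> 'b::countable" and f :: "'b \<Rightarrow> ennreal"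
  assumes X: "X \<in> measurable M (count_space UNIV)"
  shows "(\<integral>\<^sup>+\<omega>. f (X \<omega>) \<partial>M) =
    (\<integral>\<^sup>+x. f x * emeasure M {\<omega> \<in> space M. X \<omega> = x} \<partial>count_space UNIV)"
proof -
  note X[measurable]
  have "f (X \<omega>) = (\<integral>\<^sup>+x. f x * indicator {\<omega> \<in> space M. X \<omega> = x} \<omega> \<partial>count_space UNIV)"
    if "\<omega> \<in> space M" for \<omega>
  proof -
    have "(\<integral>\<^sup>+x. f x * indicator {\<omega> \<in> space M. X \<omega> = x} \<omega> \<partial>count_space UNIV) =
        (\<integral>\<^sup>+x. f x * indicator {X \<omega>} x \<partial>count_space UNIV)"
      using that by (intro nn_integral_cong) (auto simp: indicator_def)
    also have "\<dots> = f (X \<omega>)"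
      by (subst nn_integral_indicator_singleton) auto
    finally show ?thesis by simp
  qed
  then have "(\<integral>\<^sup>+\<omega>. f (X \<omega>) \<partial>M) =
      (\<integral>\<^sup>+\<omega>. (\<integral>\<^sup>+x. f x * indicator {\<omega> \<in> space M. X \<omega> = x} \<omega> \<partial>count_space UNIV) \<partial>M)"
    by (rule nn_integral_cong)
  also have "\<dots> = (\<integral>\<^sup>+x. (\<integral>\<^sup>+\<omega>. f x * indicator {\<omega> \<in> space M. X \<omega> = x} \<omega> \<partial>M) \<partial>count_space UNIV)"
    by (rule nn_integral_count_space_nn_integral) auto
  also have "\<dots> = (\<integral>\<^sup>+x. f x * emeasure M {\<omega> \<in> space M. X \<omega> = x} \<partial>count_space UNIV)"
    by (intro nn_integral_cong nn_integral_cmult_indicator) simp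
  finally show ?thesis .
qed

lemma markov_chain_measurable:
  assumes "markov_chain M S K s0 Z"
  shows "Z n \<in> measurable M (count_space UNIV)"
proof -
  have "Z n \<in> measurable M (count_space S)"
    using assms by (auto simp: markov_chain_def)
  from measurable_compose[OF this, of "\<lambda>s. s" "count_space UNIV"]
  show ?thesis by simp
qed

lemma measurable_history:
  fixes Z :: "nat \<Rightarrow> 'a \<Rightarrow> 's::countable"
  assumes [measurable]: "\<And>n. Z n \<in> measurable M (count_space UNIV)"
  shows "(\<lambda>\<omega>. map (\<lambda>i. Z i \<omega>) [0..<n]) \<in> measurable M (count_space UNIV)"
proof (induction n)
  case (Suc n)
  note Suc[measurable]
  have "(\<lambda>\<omega>. (\<lambda>(l, s). l @ [s]) (map (\<lambda>i. Z i \<omega>) [0..<n], Z n \<omega>)) \<in> measurable M (count_space UNIV)"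
    by (rule measurable_compose[of _ _ "count_space UNIV \<Otimes>\<^sub>M count_space UNIV"])
       (auto simp: pair_measure_countable)
  then show ?case by simp
qed simp

text \<open>The product form also covers histories of probability zero, where the conditional law
  says nothing: the left event lies in the null event on the right.\<close>

lemma markov_chain_emeasure_step:
  assumes "prob_space M" "markov_chain M S K s0 Z"
  shows "emeasure M {\<omega> \<in> space M. (\<forall>i\<le>n. Z i \<omega> = s i) \<and> Z (Suc n) \<omega> = t} =
    emeasure M {\<omega> \<in> space M. \<forall>i\<le>n. Z i \<omega> = s i} * ennreal (pmf (K (s n)) t)"
proof -
  interpret prob_space M by fact
  note markov_chain_measurable[OF assms(2), measurable]
  let ?A = "{\<omega> \<in> space M. \<forall>i\<le>n. Z i \<omega> = s i}"
  let ?B = "{\<omega> \<in> space M. (\<forall>i\<le>n. Z i \<omega> = s i) \<and> Z (Suc n) \<omega> = t}"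
  have "prob ?B = prob ?A * pmf (K (s n)) t"
  proof (cases "prob ?A > 0")
    case True
    then have "\<P>(\<omega> in M. Z (Suc n) \<omega> = t \<bar> \<forall>i\<le>n. Z i \<omega> = s i) = pmf (K (s n)) t"
      using assms(2) by (auto simp: markov_chain_def)
    then show ?thesis
      using True by (simp add: cond_prob_def field_simps conj_commute)
  next
    case False
    moreover have "prob ?B \<le> prob ?A"
      by (intro finite_measure_mono) auto
    ultimately show ?thesis
      by (simp add: zero_less_measure_iff measure_le_0_iff)
  qed
  then show ?thesis
    by (simp add: emeasure_eq_measure ennreal_mult)
qed

text \<open>Tower property, obtained by summing over all histories. The integrand \<open>g\<close>
  sees the whole history, because survival up to time \<open>n\<close> is an event about the whole
  path.\<close>

lemma markov_chain_nn_integral_step: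
  fixes Z :: "nat \<Rightarrow> 'a \<Rightarrow> 's::countable"
  assumes M: "prob_space M" and Z: "markov_chain M S K s0 Z"
  shows "(\<integral>\<^sup>+\<omega>. g (map (\<lambda>i. Z i \<omega>) [0..<Suc n]) (Z (Suc n) \<omega>) \<partial>M) =
    (\<integral>\<^sup>+\<omega>. (\<integral>\<^sup>+t. g (map (\<lambda>i. Z i \<omega>) [0..<Suc n]) t \<partial>K (Z n \<omega>)) \<partial>M)"
proof -
  note meas[measurable] = markov_chain_measurable[OF Z]
  define H where "H = (\<lambda>\<omega>. map (\<lambda>i. Z i \<omega>) [0..<Suc n])"
  have H[measurable]: "H \<in> measurable M (count_space UNIV)"
    unfolding H_def by (rule measurable_history) simp
  have H_eq: "H \<omega> = l \<longleftrightarrow> length l = Suc n \<and> (\<forall>i\<le>n. Z i \<omega> = l ! i)" for \<omega> l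
    by (auto simp: H_def list_eq_iff_nth_eq less_Suc_eq_le simp del: upt_Suc)
  \<comment> \<open>A list of any length other than \<open>Suc n\<close> is no possible history, and
    both sides are then zero.\<close>
  have joint: "emeasure M {\<omega> \<in> space M. H \<omega> = l \<and> Z (Suc n) \<omega> = t} =
      emeasure M {\<omega> \<in> space M. H \<omega> = l} * ennreal (pmf (K (l ! n)) t)" for l t
    using markov_chain_emeasure_step[OF M Z, of n "\<lambda>i. l ! i" t]
    by (cases "length l = Suc n") (simp_all add: H_eq)
  have pair: "(\<lambda>\<omega>. (H \<omega>, Z (Suc n) \<omega>)) \<in> measurable M (count_space UNIV)"
    using measurable_Pair[OF H meas[of "Suc n"]] by (simp add: pair_measure_countable)
  have "(\<integral>\<^sup>+\<omega>. g (H \<omega>) (Z (Suc n) \<omega>) \<partial>M) =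
      (\<integral>\<^sup>+p. g (fst p) (snd p) * emeasure M {\<omega> \<in> space M. (H \<omega>, Z (Suc n) \<omega>) = p} \<partial>count_space UNIV)"
    using nn_integral_countable_valued[OF pair, of "\<lambda>p. g (fst p) (snd p)"] by simp
  also have "\<dots> = (\<integral>\<^sup>+l. \<integral>\<^sup>+t. g l t * emeasure M {\<omega> \<in> space M. H \<omega> = l \<and> Z (Suc n) \<omega> = t}
      \<partial>count_space UNIV \<partial>count_space UNIV)"
    by (subst nn_integral_fst_count_space[symmetric]) simp
  also have "\<dots> = (\<integral>\<^sup>+l. (\<integral>\<^sup>+t. g l t \<partial>K (l ! n)) * emeasure M {\<omega> \<in> space M. H \<omega> = l}
      \<partial>count_space UNIV)"
    unfolding joint nn_integral_measure_pmf
    by (subst nn_integral_multc[symmetric]) (auto intro!: nn_integral_cong simp: mult_ac)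
  also have "\<dots> = (\<integral>\<^sup>+\<omega>. (\<integral>\<^sup>+t. g (H \<omega>) t \<partial>K (H \<omega> ! n)) \<partial>M)"
    by (rule nn_integral_countable_valued[OF H, symmetric])
  also have "\<dots> = (\<integral>\<^sup>+\<omega>. (\<integral>\<^sup>+t. g (H \<omega>) t \<partial>K (Z n \<omega>)) \<partial>M)"
    by (intro nn_integral_cong) (simp add: H_def del: upt_Suc)
  finally show ?thesis by (simp only: H_def)
qed

section \<open>Expectations killed on entering a set\<close>

text \<open>Survival includes time \<open>n\<close> itself, so that for the target set the event is
  exactly \<open>n < \<tau>\<close>.\<close>

definition killed_expectation ::
  "'a measure \<Rightarrow> (nat \<Rightarrow> 'a \<Rightarrow> 's) \<Rightarrow> 's set \<Rightarrow> nat \<Rightarrow> ('s \<Rightarrow> ennreal) \<Rightarrow> ennreal" where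
  "killed_expectation M Z D n h = (\<integral>\<^sup>+\<omega>. (if \<forall>i\<le>n. Z i \<omega> \<notin> D then h (Z n \<omega>) else 0) \<partial>M)"

text \<open>The next state is allowed to lie in \<open>D\<close>: the last triangle, which ends in
  the target, belongs to the area.\<close>

lemma nn_integral_killed_step:
  fixes Z :: "nat \<Rightarrow> 'a \<Rightarrow> 's::countable"
  assumes "prob_space M" "markov_chain M S K s0 Z"
  shows "(\<integral>\<^sup>+\<omega>. (if \<forall>i\<le>n. Z i \<omega> \<notin> D then h (Z n \<omega>) (Z (Suc n) \<omega>) else 0) \<partial>M) =
    killed_expectation M Z D n (\<lambda>s. \<integral>\<^sup>+t. h s t \<partial>K s)"
proof -
  define g where "g = (\<lambda>l t. if set l \<inter> D = {} then h (last l) t else 0)"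
  have g: "g (map (\<lambda>i. Z i \<omega>) [0..<Suc n]) t =
      (if \<forall>i\<le>n. Z i \<omega> \<notin> D then h (Z n \<omega>) t else 0)" for \<omega> t
  proof -
    have "set (map (\<lambda>i. Z i \<omega>) [0..<Suc n]) \<inter> D = {} \<longleftrightarrow> (\<forall>i\<le>n. Z i \<omega> \<notin> D)"
      by (force simp: disjoint_iff image_iff less_Suc_eq_le simp del: upt_Suc)
    moreover have "last (map (\<lambda>i. Z i \<omega>) [0..<Suc n]) = Z n \<omega>"
      by simp
    ultimately show ?thesis by (simp only: g_def)
  qed
  have "(\<integral>\<^sup>+t. (if P then h s t else 0) \<partial>K s) = (if P then \<integral>\<^sup>+t. h s t \<partial>K s else 0)" for P s
    by simp
  with markov_chain_nn_integral_step[OF assms, of g n] show ?thesis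
    unfolding g killed_expectation_def by simp
qed

text \<open>Since \<open>h\<close> vanishes on \<open>D\<close>, survival at time
  \<open>Suc n\<close> imposes nothing beyond survival up to time \<open>n\<close>, and the one-step
  formula applies.\<close>

lemma killed_expectation_Suc:
  fixes Z :: "nat \<Rightarrow> 'a \<Rightarrow> 's::countable"
  assumes "prob_space M" "markov_chain M S K s0 Z" "\<And>s. s \<in> D \<Longrightarrow> h s = 0"
  shows "killed_expectation M Z D (Suc n) h = killed_expectation M Z D n (\<lambda>s. \<integral>\<^sup>+t. h t \<partial>K s)"
proof -
  have "killed_expectation M Z D (Suc n) h =
      (\<integral>\<^sup>+\<omega>. (if \<forall>i\<le>n. Z i \<omega> \<notin> D then h (Z (Suc n) \<omega>) else 0) \<partial>M)"
    unfolding killed_expectation_def using assms(3)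
    by (intro nn_integral_cong) (auto simp: le_Suc_eq)
  then show ?thesis
    using nn_integral_killed_step[OF assms(1,2), of n D "\<lambda>_. h"] by simp
qed

lemma measurable_killed:
  fixes Z :: "nat \<Rightarrow> 'a \<Rightarrow> 's::countable"
  assumes [measurable]: "\<And>n. Z n \<in> measurable M (count_space UNIV)"
  shows "(\<lambda>\<omega>. if \<forall>i\<le>n. Z i \<omega> \<notin> D then h (Z n \<omega>) (Z (Suc n) \<omega>) else 0 :: ennreal)
    \<in> borel_measurable M"
proof -
  have [measurable]: "(\<lambda>\<omega>. h (Z n \<omega>) (Z (Suc n) \<omega>)) \<in> borel_measurable M"
  proof -
    have "(\<lambda>\<omega>. (Z n \<omega>, Z (Suc n) \<omega>)) \<in> measurable M (count_space UNIV)"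
      using measurable_Pair[of "Z n" M "count_space UNIV" "Z (Suc n)" "count_space UNIV"]
      by (simp add: pair_measure_countable)
    from measurable_compose[OF this, of "\<lambda>p. h (fst p) (snd p)" borel]
    show ?thesis by simp
  qed
  show ?thesis by measurable
qed

text \<open>Every path stays in \<open>S\<close> and contributes only outside \<open>D\<close>. The
  comparison is thus needed only where the urn estimates hold, away from the origin and the
  target.\<close>

lemma killed_expectation_mono:
  assumes "\<And>n. Z n \<in> measurable M (count_space S)" "\<And>s. s \<in> S - D \<Longrightarrow> f s \<le> g s"
  shows "killed_expectation M Z D n f \<le> killed_expectation M Z D n g"
  unfolding killed_expectation_def
  using assms(2) measurable_space[OF assms(1)]
  by (intro nn_integral_mono) auto

lemma killed_expectation_cong:
  assumes "\<And>n. Z n \<in> measurable M (count_space S)" "\<And>s. s \<in> S - D \<Longrightarrow> f s = g s"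
  shows "killed_expectation M Z D n f = killed_expectation M Z D n g"
  using assms by (intro antisym killed_expectation_mono) auto

lemma killed_expectation_linear:
  fixes Z :: "nat \<Rightarrow> 'a \<Rightarrow> 's::countable"
  assumes "\<And>n. Z n \<in> measurable M (count_space UNIV)"
  shows "killed_expectation M Z D n (\<lambda>s. a * f s + b * g s) =
    a * killed_expectation M Z D n f + b * killed_expectation M Z D n g"
proof -
  have meas: "(\<lambda>\<omega>. if \<forall>i\<le>n. Z i \<omega> \<notin> D then h (Z n \<omega>) else 0 :: ennreal) \<in> borel_measurable M" for h
    using measurable_killed[OF assms, where n = n and D = D and h = "\<lambda>s _. h s"] .
  have "killed_expectation M Z D n (\<lambda>s. a * f s + b * g s) =
     (\<integral>\<^sup>+\<omega>. a * (if \<forall>i\<le>n. Z i \<omega> \<notin> D then f (Z n \<omega>) else 0)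
        + b * (if \<forall>i\<le>n. Z i \<omega> \<notin> D then g (Z n \<omega>) else 0) \<partial>M)"
    unfolding killed_expectation_def by (intro nn_integral_cong) auto
  also have "\<dots> = a * killed_expectation M Z D n f + b * killed_expectation M Z D n g"
    unfolding killed_expectation_def using meas by (simp add: nn_integral_add nn_integral_cmult)
  finally show ?thesis .
qed

lemma killed_expectation_0:
  assumes "prob_space M" "markov_chain M S K s0 Z" "s0 \<notin> D"
  shows "killed_expectation M Z D 0 h = h s0"
proof -
  interpret prob_space M by fact
  have "AE \<omega> in M. Z 0 \<omega> = s0"
    using assms(2) by (simp add: markov_chain_def)
  then have "killed_expectation M Z D 0 h = (\<integral>\<^sup>+\<omega>. h s0 \<partial>M)"
    unfolding killed_expectation_def
    by (intro nn_integral_cong_AE, elim eventually_mono) (use assms(3) in auto)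
  then show ?thesis by (simp add: emeasure_space_1)
qed

section \<open>The martingale function and the areas of the triangles\<close>

definition urn_size :: "int \<times> int \<Rightarrow> real" where
  "urn_size = (\<lambda>(x, y). real_of_int (\<bar>x\<bar> + \<bar>y\<bar>))"

text \<open>The linear correction cancels the unit drift of \<open>x\<^sup>2 + y\<^sup>2\<close> per step off the axes and matches the
  loss at each axis crossing.\<close>

definition urn_mart :: "int \<times> int \<Rightarrow> real" where
  "urn_mart = (\<lambda>(x, y). real_of_int (x\<^sup>2 + y\<^sup>2 +
     (if x * y > 0 then \<bar>x\<bar> - \<bar>y\<bar> else if x * y < 0 then \<bar>y\<bar> - \<bar>x\<bar> else - \<bar>x\<bar> - \<bar>y\<bar>)))"

definition step_area :: "int \<times> int \<Rightarrow> int \<times> int \<Rightarrow> real" where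
  "step_area s t = real_of_int \<bar>fst s * snd t - snd s * fst t\<bar> / 2"

lemma measure_triangle_plane_point:
  "measure lebesgue (convex hull {0, plane_point s, plane_point t}) = step_area s t"
proof -
  have "compact (convex hull {0, plane_point s, plane_point t})"
    by (intro finite_imp_compact_convex_hull) simp
  then have "measure lebesgue (convex hull {0, plane_point s, plane_point t}) =
      measure lborel (convex hull {0, plane_point s, plane_point t})"
    by (intro measure_completion) (auto dest: compact_imp_closed)
  then show ?thesis
    by (simp add: content_triangle plane_point_def step_area_def abs_minus_commute mult.commute)
qed

text \<open>Integrality lets the squares dominate the linear correction in
  \<open>urn_mart\<close>.\<close>

lemma square_int_ge_abs: "\<bar>k\<bar> \<le> k\<^sup>2" for k :: int
  using self_le_power[of "\<bar>k\<bar>" 2] by (cases "k = 0") (auto simp: power2_abs)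

lemma urn_mart_nonneg: "0 \<le> urn_mart s"
proof (cases s)
  case (Pair x y)
  have "0 \<le> x\<^sup>2 + y\<^sup>2 +
     (if x * y > 0 then \<bar>x\<bar> - \<bar>y\<bar> else if x * y < 0 then \<bar>y\<bar> - \<bar>x\<bar> else - \<bar>x\<bar> - \<bar>y\<bar>)"
    using square_int_ge_abs[of x] square_int_ge_abs[of y] by (smt (verit))
  then show ?thesis
    unfolding Pair urn_mart_def prod.case by (simp only: of_int_0_le_iff)
qed

lemma urn_mart_le: "urn_mart s \<le> 2 * (urn_size s)\<^sup>2"
proof (cases s)
  case (Pair x y)
  have 1: "\<bar>x\<bar> + \<bar>y\<bar> \<le> (\<bar>x\<bar> + \<bar>y\<bar>)\<^sup>2"
    using square_int_ge_abs[of "\<bar>x\<bar> + \<bar>y\<bar>"] by simp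
  have 2: "(\<bar>x\<bar> + \<bar>y\<bar>)\<^sup>2 = x\<^sup>2 + y\<^sup>2 + 2 * (\<bar>x\<bar> * \<bar>y\<bar>)"
    by (simp add: power2_sum)
  have "0 \<le> \<bar>x\<bar> * \<bar>y\<bar>" by simp
  with 1 2 have "x\<^sup>2 + y\<^sup>2 +
     (if x * y > 0 then \<bar>x\<bar> - \<bar>y\<bar> else if x * y < 0 then \<bar>y\<bar> - \<bar>x\<bar> else - \<bar>x\<bar> - \<bar>y\<bar>)
     \<le> 2 * (\<bar>x\<bar> + \<bar>y\<bar>)\<^sup>2"
    by (smt (verit))
  then have "real_of_int (x\<^sup>2 + y\<^sup>2 +
     (if x * y > 0 then \<bar>x\<bar> - \<bar>y\<bar> else if x * y < 0 then \<bar>y\<bar> - \<bar>x\<bar> else - \<bar>x\<bar> - \<bar>y\<bar>))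
     \<le> real_of_int (2 * (\<bar>x\<bar> + \<bar>y\<bar>)\<^sup>2)"
    by (simp only: of_int_le_iff)
  then show ?thesis using Pair by (simp add: urn_mart_def urn_size_def)
qed

text \<open>Each half-axis is joined to the quadrant from which the rotating chain enters it, so one
  formula covers every step out of a quadrant, including the one that lands on an axis.\<close>

lemma urn_mart_eq:
  "x * y > 0 \<or> x = 0 \<Longrightarrow> urn_mart (x, y) =
     (real_of_int \<bar>x\<bar>)\<^sup>2 + (real_of_int \<bar>y\<bar>)\<^sup>2 + real_of_int \<bar>x\<bar> - real_of_int \<bar>y\<bar>"
  "x * y < 0 \<or> y = 0 \<Longrightarrow> urn_mart (x, y) =
     (real_of_int \<bar>x\<bar>)\<^sup>2 + (real_of_int \<bar>y\<bar>)\<^sup>2 + real_of_int \<bar>y\<bar> - real_of_int \<bar>x\<bar>"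
  by (auto simp: urn_mart_def)

text \<open>The increments are weighted by \<open>\<bar>x\<bar>\<close> and
  \<open>\<bar>y\<bar>\<close> respectively, hence have mean 0 and variance
  \<open>4 * \<bar>x\<bar> * \<bar>y\<bar>\<close>. The last bound will control one coordinate by
  the square root of \<open>urn_mart\<close>.\<close>

lemma urn_mart_pos_quadrant:
  assumes "x * y > 0"
  shows "urn_mart (x, y + sgn x) = urn_mart (x, y) + 2 * real_of_int \<bar>y\<bar>"
    and "urn_mart (x - sgn y, y) = urn_mart (x, y) - 2 * real_of_int \<bar>x\<bar>"
    and "(real_of_int x)\<^sup>2 \<le> urn_mart (x, y)"
proof -
  have "x > 0 \<and> y > 0 \<or> x < 0 \<and> y < 0"
    using assms by (simp add: zero_less_mult_iff)
  then have abs: "\<bar>y + sgn x\<bar> = \<bar>y\<bar> + 1" "\<bar>x - sgn y\<bar> = \<bar>x\<bar> - 1"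
    and sgn: "x * (y + sgn x) > 0 \<or> x = 0" "(x - sgn y) * y > 0 \<or> x - sgn y = 0"
    by (auto simp: zero_less_mult_iff)
  show "urn_mart (x, y + sgn x) = urn_mart (x, y) + 2 * real_of_int \<bar>y\<bar>"
    unfolding urn_mart_eq(1)[OF sgn(1)] urn_mart_eq(1)[OF disjI1[OF assms]] abs
    by (simp add: power2_eq_square algebra_simps)
  show "urn_mart (x - sgn y, y) = urn_mart (x, y) - 2 * real_of_int \<bar>x\<bar>"
    unfolding urn_mart_eq(1)[OF sgn(2)] urn_mart_eq(1)[OF disjI1[OF assms]] abs
    by (simp add: power2_eq_square algebra_simps)
  have "x\<^sup>2 \<le> x\<^sup>2 + y\<^sup>2 + (\<bar>x\<bar> - \<bar>y\<bar>)"
    using square_int_ge_abs[of y] by linarith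
  then have "real_of_int (x\<^sup>2) \<le> real_of_int (x\<^sup>2 + y\<^sup>2 + (\<bar>x\<bar> - \<bar>y\<bar>))"
    by (simp only: of_int_le_iff)
  then show "(real_of_int x)\<^sup>2 \<le> urn_mart (x, y)"
    using assms by (simp add: urn_mart_def)
qed

text \<open>Mirror image of the other quadrants: the two coordinates exchange their roles.\<close>

lemma urn_mart_neg_quadrant:
  assumes "x * y < 0"
  shows "urn_mart (x, y + sgn x) = urn_mart (x, y) - 2 * real_of_int \<bar>y\<bar>"
    and "urn_mart (x - sgn y, y) = urn_mart (x, y) + 2 * real_of_int \<bar>x\<bar>"
    and "(real_of_int y)\<^sup>2 \<le> urn_mart (x, y)"
proof -
  have "x > 0 \<and> y < 0 \<or> x < 0 \<and> y > 0"
    using assms by (simp add: mult_less_0_iff)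
  then have abs: "\<bar>y + sgn x\<bar> = \<bar>y\<bar> - 1" "\<bar>x - sgn y\<bar> = \<bar>x\<bar> + 1"
    and sgn: "x * (y + sgn x) < 0 \<or> y + sgn x = 0" "(x - sgn y) * y < 0 \<or> y = 0"
    by (auto simp: mult_less_0_iff)
  show "urn_mart (x, y + sgn x) = urn_mart (x, y) - 2 * real_of_int \<bar>y\<bar>"
    unfolding urn_mart_eq(2)[OF sgn(1)] urn_mart_eq(2)[OF disjI1[OF assms]] abs
    by (simp add: power2_eq_square algebra_simps)
  show "urn_mart (x - sgn y, y) = urn_mart (x, y) + 2 * real_of_int \<bar>x\<bar>"
    unfolding urn_mart_eq(2)[OF sgn(2)] urn_mart_eq(2)[OF disjI1[OF assms]] abs
    by (simp add: power2_eq_square algebra_simps)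
  have "y\<^sup>2 \<le> x\<^sup>2 + y\<^sup>2 + (\<bar>y\<bar> - \<bar>x\<bar>)"
    using square_int_ge_abs[of x] by linarith
  then have "real_of_int (y\<^sup>2) \<le> real_of_int (x\<^sup>2 + y\<^sup>2 + (\<bar>y\<bar> - \<bar>x\<bar>))"
    by (simp only: of_int_le_iff)
  then show "(real_of_int y)\<^sup>2 \<le> urn_mart (x, y)"
    using assms by (simp add: urn_mart_def)
qed

text \<open>The bound on \<open>y\<close> makes the maximum equal to
  \<open>\<bar>y\<bar> - 1\<close>, and both sides are
  \<open>\<bar>y\<bar> * (\<bar>y\<bar> - 1)\<close>. For \<open>\<bar>y\<bar> = 1\<close> the value
  would jump from 0 to 2, so the martingale has to stop at the target.\<close>

lemma urn_mart_axis_fst: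
  assumes "\<bar>y\<bar> \<ge> 2"
  shows "urn_mart (- sgn y, sgn y * max 1 (\<bar>y\<bar> - 1)) = urn_mart (0, y)"
proof -
  have abs: "\<bar>- sgn y\<bar> = 1" "\<bar>sgn y * max 1 (\<bar>y\<bar> - 1)\<bar> = \<bar>y\<bar> - 1"
    using assms by (auto simp: abs_mult)
  have "- sgn y * (sgn y * max 1 (\<bar>y\<bar> - 1)) < 0 \<or> sgn y * max 1 (\<bar>y\<bar> - 1) = 0"
    by (cases y "0::int" rule: linorder_cases) auto
  from urn_mart_eq(2)[OF this] show ?thesis
    unfolding abs using assms
    by (simp add: urn_mart_eq(1)[of 0] power2_eq_square algebra_simps)
qed

lemma urn_mart_axis_snd:
  assumes "\<bar>x\<bar> \<ge> 2"
  shows "urn_mart (sgn x * max 1 (\<bar>x\<bar> - 1), sgn x) = urn_mart (x, 0)"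
proof -
  have abs: "\<bar>sgn x\<bar> = 1" "\<bar>sgn x * max 1 (\<bar>x\<bar> - 1)\<bar> = \<bar>x\<bar> - 1"
    using assms by (auto simp: abs_mult)
  have "sgn x * max 1 (\<bar>x\<bar> - 1) * sgn x > 0 \<or> sgn x * max 1 (\<bar>x\<bar> - 1) = 0"
    by (cases x "0::int" rule: linorder_cases) auto
  from urn_mart_eq(1)[OF this] show ?thesis
    unfolding abs using assms
    by (simp add: urn_mart_eq(2)[of _ 0] power2_eq_square algebra_simps)
qed

section \<open>One-step means for the urn\<close>

lemma nn_integral_noisy_urn_step:
  assumes "x \<noteq> 0" "y \<noteq> 0" and f: "\<And>s. 0 \<le> f s"
  shows "(\<integral>\<^sup>+t. ennreal (f t) \<partial>noisy_urn_step (x, y)) =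
    ennreal ((\<bar>real_of_int x\<bar> * f (x, y + sgn x) + \<bar>real_of_int y\<bar> * f (x - sgn y, y)) / urn_size (x, y))"
proof -
  define p where "p = real_of_int \<bar>x\<bar> / real_of_int (\<bar>x\<bar> + \<bar>y\<bar>)"
  have p: "0 \<le> p" "p \<le> 1" "1 - p = \<bar>real_of_int y\<bar> / real_of_int (\<bar>x\<bar> + \<bar>y\<bar>)"
    using assms by (auto simp: p_def field_simps add_pos_nonneg)
  have "(\<integral>\<^sup>+t. ennreal (f t) \<partial>noisy_urn_step (x, y)) =
      ennreal (f (x, y + sgn x)) * ennreal p + ennreal (f (x - sgn y, y)) * ennreal (1 - p)"
    using assms(1,2) p(1,2) by (simp add: noisy_urn_step_def flip: p_def del: of_int_abs of_int_add)
  also have "ennreal (f (x, y + sgn x)) * ennreal p + ennreal (f (x - sgn y, y)) * ennreal (1 - p)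
      = ennreal (f (x, y + sgn x) * p + f (x - sgn y, y) * (1 - p))"
    using p(1,2) f by (simp add: ennreal_mult ennreal_plus)
  also have "f (x, y + sgn x) * p + f (x - sgn y, y) * (1 - p) = 
    (\<bar>real_of_int x\<bar> * f (x, y + sgn x) + \<bar>real_of_int y\<bar> * f (x - sgn y, y)) / urn_size (x, y)"
    unfolding p(3) by (simp add: p_def urn_size_def add_divide_distrib mult.commute)
  finally show ?thesis .
qed

lemma nn_integral_noisy_urn_step_axis:
  "(\<integral>\<^sup>+t. ennreal (f t) \<partial>noisy_urn_step (0, y)) = ennreal (f (- sgn y, sgn y * max 1 (\<bar>y\<bar> - 1)))"
  "x \<noteq> 0 \<Longrightarrow> (\<integral>\<^sup>+t. ennreal (f t) \<partial>noisy_urn_step (x, 0)) = ennreal (f (sgn x * max 1 (\<bar>x\<bar> - 1), sgn x))"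
  by (simp_all add: noisy_urn_step_def nn_integral_return)

text \<open>Off the axes the two weighted increments are both
  \<open>2 * \<bar>x\<bar> * \<bar>y\<bar>\<close> in absolute value and have opposite signs. On the
  axes the step is deterministic and preserves \<open>urn_mart\<close>.\<close>

lemma urn_mart_harmonic:
  assumes "urn_size s \<ge> 2"
  shows "(\<integral>\<^sup>+t. ennreal (urn_mart t) \<partial>noisy_urn_step s) = ennreal (urn_mart s)"
proof (cases s)
  case (Pair x y)
  consider "x = 0" | "x \<noteq> 0" "y = 0" | "x * y > 0" | "x * y < 0"
    by (metis linorder_less_linear mult_eq_0_iff)
  then show ?thesis
  proof cases
    case 1
    then show ?thesis
      using assms urn_mart_axis_fst[of y]
      by (simp add: Pair nn_integral_noisy_urn_step_axis urn_size_def)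
  next
    case 2
    then show ?thesis
      using assms urn_mart_axis_snd[of x]
      by (simp add: Pair nn_integral_noisy_urn_step_axis urn_size_def)
  next
    case 3
    then have "x \<noteq> 0" "y \<noteq> 0" by auto
    then have "urn_size (x, y) > 0" by (simp add: urn_size_def)
    then show ?thesis
      unfolding Pair nn_integral_noisy_urn_step[OF \<open>x \<noteq> 0\<close> \<open>y \<noteq> 0\<close> urn_mart_nonneg] urn_mart_pos_quadrant(1,2)[OF 3]
      by (intro arg_cong[where f = ennreal]) (simp add: field_simps urn_size_def)
  next
    case 4
    then have "x \<noteq> 0" "y \<noteq> 0" by auto
    then have "urn_size (x, y) > 0" by (simp add: urn_size_def)
    then show ?thesis
      unfolding Pair nn_integral_noisy_urn_step[OF \<open>x \<noteq> 0\<close> \<open>y \<noteq> 0\<close> urn_mart_nonneg] urn_mart_neg_quadrant(1,2)[OF 4]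
      by (intro arg_cong[where f = ennreal]) (simp add: field_simps urn_size_def)
  qed
qed

section \<open>The drift of the power 3/2\<close>

text \<open>With \<open>s = sqrt u\<close> and \<open>t = sqrt (u + d)\<close>, the first-order
  remainder is exactly \<open>(t - s)^2 * (t + s / 2)\<close>, while
  \<open>d^2 = (t - s)^2 * (t + s)^2\<close>. The bound therefore holds for large and for negative
  \<open>d\<close> as well.\<close>

lemma sqrt_cube_taylor_le:
  fixes u d :: real
  assumes "u > 0" "u + d \<ge> 0"
  shows "sqrt (u + d) ^ 3 \<le> sqrt u ^ 3 + 3 / 2 * sqrt u * d + d\<^sup>2 / sqrt u"
proof -
  define s t where "s = sqrt u" and "t = sqrt (u + d)"
  have s: "s > 0" and t: "t \<ge> 0" and d: "d = t\<^sup>2 - s\<^sup>2"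
    using assms by (auto simp: s_def t_def)
  have "s * (t + s / 2) \<le> (t + s)\<^sup>2"
    using s t by (simp add: power2_eq_square algebra_simps)
  then have "(t - s)\<^sup>2 * (s * (t + s / 2)) \<le> (t - s)\<^sup>2 * (t + s)\<^sup>2"
    by (rule mult_left_mono) simp
  then have "(t - s)\<^sup>2 * (t + s / 2) \<le> d\<^sup>2 / s"
    using s by (simp add: field_simps d power2_eq_square)
  moreover have "t ^ 3 = s ^ 3 + 3 / 2 * s * d + (t - s)\<^sup>2 * (t + s / 2)"
    by (simp add: d power2_eq_square power3_eq_cube field_simps)
  ultimately show ?thesis by (simp add: s_def t_def)
qed

text \<open>Here \<open>a\<close> and \<open>b\<close> stand for the absolute coordinates, and
  \<open>c\<close> and \<open>d\<close> for the increments of \<open>urn_mart\<close>. Zero mean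
  removes the first-order term and the variance leaves \<open>4 * a * b / sqrt u\<close>. As one of
  \<open>a\<close> and \<open>b\<close> is at most \<open>sqrt u\<close>, this is at most
  \<open>4 * (a + b)\<close>.\<close>

lemma weighted_sqrt_cube_le:
  fixes a b u c d :: real
  assumes ab: "a > 0" "b > 0" and u: "u > 0" "u + c \<ge> 0" "u + d \<ge> 0"
    and mean: "a * c + b * d = 0" and var: "a * c\<^sup>2 + b * d\<^sup>2 = 4 * a * b * (a + b)"
    and le: "a\<^sup>2 \<le> u \<or> b\<^sup>2 \<le> u"
  shows "(a * sqrt (u + c) ^ 3 + b * sqrt (u + d) ^ 3) / (a + b) \<le> sqrt u ^ 3 + 4 * (a + b)"
proof -
  have "a * sqrt (u + c) ^ 3 + b * sqrt (u + d) ^ 3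
      \<le> a * (sqrt u ^ 3 + 3 / 2 * sqrt u * c + c\<^sup>2 / sqrt u) + b * (sqrt u ^ 3 + 3 / 2 * sqrt u * d + d\<^sup>2 / sqrt u)"
    using ab u by (intro add_mono mult_left_mono sqrt_cube_taylor_le) auto
  also have "\<dots> = (a + b) * sqrt u ^ 3 + 3 / 2 * sqrt u * (a * c + b * d) + (a * c\<^sup>2 + b * d\<^sup>2) / sqrt u"
    by (simp add: algebra_simps add_divide_distrib)
  also have "\<dots> = (a + b) * (sqrt u ^ 3 + 4 * (a * b / sqrt u))"
    unfolding mean var by (simp add: algebra_simps)
  finally have 1: "(a * sqrt (u + c) ^ 3 + b * sqrt (u + d) ^ 3) / (a + b) \<le> sqrt u ^ 3 + 4 * (a * b / sqrt u)"
    using ab by (simp add: field_simps)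
  have "a \<le> sqrt u \<or> b \<le> sqrt u"
    using le by (auto intro: real_le_rsqrt)
  then have "a * b \<le> (a + b) * sqrt u"
  proof
    assume "a \<le> sqrt u"
    then have "a * b \<le> sqrt u * b" using ab by simp
    also have "\<dots> \<le> (a + b) * sqrt u" using ab u by (simp add: algebra_simps)
    finally show ?thesis .
  next
    assume "b \<le> sqrt u"
    then have "a * b \<le> a * sqrt u" using ab by simp
    also have "\<dots> \<le> (a + b) * sqrt u" using ab u by (simp add: algebra_simps)
    finally show ?thesis .
  qed
  then have "a * b / sqrt u \<le> a + b"
    using u by (simp add: field_simps)
  then have "sqrt u ^ 3 + 4 * (a * b / sqrt u) \<le> sqrt u ^ 3 + 4 * (a + b)"
    by simp
  with 1 show ?thesis by (rule order_trans)
qed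

lemma urn_mart_sqrt_cube_drift:
  assumes "urn_size s \<ge> 2"
  shows "(\<integral>\<^sup>+t. ennreal (sqrt (urn_mart t) ^ 3) \<partial>noisy_urn_step s) \<le>
    ennreal (sqrt (urn_mart s) ^ 3) + 4 * ennreal (urn_size s)"
proof (cases s)
  case (Pair x y)
  have nonneg: "0 \<le> sqrt (urn_mart t) ^ 3" for t
    by (simp add: urn_mart_nonneg)
  have rhs: "ennreal (sqrt (urn_mart s) ^ 3) + 4 * ennreal (urn_size s) =
      ennreal (sqrt (urn_mart s) ^ 3 + 4 * urn_size s)"
    using assms nonneg by (simp add: ennreal_plus ennreal_mult)
  consider "x = 0" | "x \<noteq> 0" "y = 0" | "x * y > 0" | "x * y < 0"
    by (metis linorder_less_linear mult_eq_0_iff)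
  then show ?thesis
  proof cases
    case 1
    then show ?thesis
      using assms urn_mart_axis_fst[of y]
      by (simp add: Pair nn_integral_noisy_urn_step_axis urn_size_def)
  next
    case 2
    then show ?thesis
      using assms urn_mart_axis_snd[of x]
      by (simp add: Pair nn_integral_noisy_urn_step_axis urn_size_def)
  next
    case 3
    then have xy: "x \<noteq> 0" "y \<noteq> 0" by auto
    have size: "urn_size (x, y) = \<bar>real_of_int x\<bar> + \<bar>real_of_int y\<bar>"
      by (simp add: urn_size_def)
    \<comment> \<open>Strict positivity of \<open>urn_mart\<close> is what the Taylor bound
      requires, since it divides by the square root.\<close>
    have "0 < (real_of_int x)\<^sup>2" using xy by simp
    with urn_mart_pos_quadrant(3)[OF 3] have "0 < urn_mart (x, y)" by linarith
    then show ?thesis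
      unfolding rhs unfolding Pair nn_integral_noisy_urn_step[OF xy nonneg] urn_mart_pos_quadrant(1,2)[OF 3] size
      using xy urn_mart_pos_quadrant(3)[OF 3] urn_mart_nonneg[of "(x - sgn y, y)"]
        urn_mart_nonneg[of "(x, y + sgn x)"] 3
        weighted_sqrt_cube_le[of "\<bar>real_of_int x\<bar>" "\<bar>real_of_int y\<bar>" "urn_mart (x, y)" "2 * real_of_int \<bar>y\<bar>" "- 2 * real_of_int \<bar>x\<bar>"]
      by (intro ennreal_leI) (simp add: urn_mart_pos_quadrant power2_eq_square algebra_simps)
  next
    case 4
    then have xy: "x \<noteq> 0" "y \<noteq> 0" by auto
    have size: "urn_size (x, y) = \<bar>real_of_int x\<bar> + \<bar>real_of_int y\<bar>"
      by (simp add: urn_size_def)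
    have "0 < (real_of_int y)\<^sup>2" using xy by simp
    with urn_mart_neg_quadrant(3)[OF 4] have "0 < urn_mart (x, y)" by linarith
    then show ?thesis
      unfolding rhs unfolding Pair nn_integral_noisy_urn_step[OF xy nonneg] urn_mart_neg_quadrant(1,2)[OF 4] size
      using xy urn_mart_neg_quadrant(3)[OF 4] urn_mart_nonneg[of "(x - sgn y, y)"]
        urn_mart_nonneg[of "(x, y + sgn x)"] 4
        weighted_sqrt_cube_le[of "\<bar>real_of_int x\<bar>" "\<bar>real_of_int y\<bar>" "urn_mart (x, y)" "- 2 * real_of_int \<bar>y\<bar>" "2 * real_of_int \<bar>x\<bar>"]
      by (intro ennreal_leI) (simp add: urn_mart_neg_quadrant power2_eq_square algebra_simps)
  qed
qed

text \<open>Off the axes the mean area is \<open>(x^2 + y^2) / (2 * r)\<close> with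
  \<open>r = \<bar>x\<bar> + \<bar>y\<bar>\<close>, and \<open>r^2 \<le> 2 * (x^2 + y^2)\<close>. On
  the axes the area is \<open>r / 2\<close>.\<close>

lemma step_area_mean_ge:
  assumes "urn_size s \<ge> 2"
  shows "ennreal (urn_size s) \<le> 4 * (\<integral>\<^sup>+t. ennreal (step_area s t) \<partial>noisy_urn_step s)"
proof (cases s)
  case (Pair x y)
  have area_up: "step_area (x, y) (x, y + sgn x) = \<bar>real_of_int x\<bar> / 2"
    by (simp add: step_area_def algebra_simps abs_mult sgn_if abs_if)
  have area_side: "step_area (x, y) (x - sgn y, y) = \<bar>real_of_int y\<bar> / 2"
    by (simp add: step_area_def algebra_simps abs_mult sgn_if abs_if)
  have nonneg: "0 \<le> step_area s t" for s t
    by (simp add: step_area_def)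
  show ?thesis
  proof (cases "x = 0 \<or> y = 0")
    case True
    then show ?thesis
    proof (cases "x = 0")
      case True
      then have "ennreal (urn_size s) \<le> ennreal (4 * (step_area (0, y) (- sgn y, sgn y * max 1 (\<bar>y\<bar> - 1))))"
        using assms by (intro ennreal_leI) (simp add: Pair urn_size_def step_area_def abs_mult sgn_if)
      then show ?thesis
        using True by (simp add: Pair nn_integral_noisy_urn_step_axis ennreal_mult' nonneg)
    next
      case x: False
      then have "ennreal (urn_size s) \<le> ennreal (4 * (step_area (x, 0) (sgn x * max 1 (\<bar>x\<bar> - 1), sgn x)))"
        using assms True by (intro ennreal_leI) (simp add: Pair urn_size_def step_area_def abs_mult sgn_if)
      then show ?thesis
        using True x by (simp add: Pair nn_integral_noisy_urn_step_axis ennreal_mult' nonneg)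
    qed
  next
    case False
    then have xy: "x \<noteq> 0" "y \<noteq> 0" by auto
    define a b where "a = \<bar>real_of_int x\<bar>" and "b = \<bar>real_of_int y\<bar>"
    have ab: "a > 0" "b > 0" "urn_size (x, y) = a + b"
      using xy by (auto simp: a_def b_def urn_size_def)
    have "(a + b)\<^sup>2 \<le> 2 * (a\<^sup>2 + b\<^sup>2)"
      using zero_le_power2[of "a - b"] by (simp add: power2_eq_square algebra_simps)
    then have "a + b \<le> 4 * ((a * (a / 2) + b * (b / 2)) / (a + b))"
      using ab(1,2) by (simp add: field_simps power2_eq_square)
    then have "ennreal (a + b) \<le> ennreal (4 * ((a * (a / 2) + b * (b / 2)) / (a + b)))"
      by (rule ennreal_leI)
    also have "\<dots> = 4 * ennreal ((a * (a / 2) + b * (b / 2)) / (a + b))"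
      using ab(1,2) by (subst ennreal_mult) (auto intro!: divide_nonneg_nonneg)
    finally show ?thesis
      unfolding Pair nn_integral_noisy_urn_step[OF xy nonneg] area_up area_side ab(3)
        a_def[symmetric] b_def[symmetric] .
  qed
qed

section \<open>The stopping time and the expected area\<close>

definition urn_target :: "(int \<times> int) set" where
  "urn_target = {(x, y). \<bar>x\<bar> + \<bar>y\<bar> = 1}"

text \<open>The triangle with index \<open>Suc k\<close> counts exactly when the chain survives
  through time \<open>k\<close>, which is the event in \<open>killed_expectation\<close>; an
  infinite stopping time is included.\<close>

lemma Suc_le_urn_tau_iff:
  "enat (Suc k) \<le> urn_tau Z \<omega> \<longleftrightarrow> (\<forall>i\<le>k. Z i \<omega> \<notin> urn_target)"
  unfolding urn_tau_def le_Inf_iff urn_target_def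
  by (auto simp: split_beta) (metis not_less_eq_eq)

text \<open>This boundary value makes \<open>killed_expectation_Suc\<close> applicable to
  \<open>urn_mart\<close> and to its power 3/2.\<close>

lemma urn_mart_target: "s \<in> urn_target \<Longrightarrow> urn_mart s = 0"
proof (cases s)
  case (Pair x y)
  assume "s \<in> urn_target"
  then have "x = 0 \<and> y = 1 \<or> x = 0 \<and> y = - 1 \<or> x = 1 \<and> y = 0 \<or> x = - 1 \<and> y = 0"
    unfolding urn_target_def Pair by simp linarith
  then show ?thesis by (auto simp: Pair urn_mart_def)
qed

lemma urn_size_ge_2: "s \<in> - {(0, 0)} - urn_target \<Longrightarrow> urn_size s \<ge> 2"
  by (cases s) (auto simp: urn_target_def urn_size_def simp flip: of_int_abs of_int_add)

text \<open>Nonnegativity allows sum and expectation to be exchanged; each triangle is then averaged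
  over the step that creates it.\<close>

lemma nn_integral_urn_area:
  assumes "prob_space M" "noisy_urn M z0 Z"
  shows "(\<integral>\<^sup>+\<omega>. urn_area Z \<omega> \<partial>M) = (\<Sum>k. killed_expectation M Z urn_target k
    (\<lambda>s. \<integral>\<^sup>+t. ennreal (step_area s t) \<partial>noisy_urn_step s))"
proof -
  have mc: "markov_chain M (- {(0, 0)}) noisy_urn_step (int z0, 1) Z"
    using assms(2) by (simp add: noisy_urn_def)
  show ?thesis
    unfolding urn_area_def Suc_le_urn_tau_iff urn_triangle_def measure_triangle_plane_point diff_Suc_1
    using measurable_killed[OF markov_chain_measurable[OF mc], where D = urn_target and h = "\<lambda>s t. ennreal (step_area s t)"]
      nn_integral_killed_step[OF assms(1) mc, of _ urn_target "\<lambda>s t. ennreal (step_area s t)"]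
    by (subst nn_integral_suminf) auto
qed

section \<open>Interpolation and the contradiction\<close>

text \<open>For \<open>v = sqrt (urn_mart s)\<close> the square \<open>v^2\<close> lies between
  \<open>v^3\<close> and \<open>v\<close>, and \<open>v \<le> 2 * urn_size s\<close>. The weight
  \<open>e\<close> is free, so the coefficient of the cube can be made small.\<close>

lemma urn_mart_interpolation:
  assumes "e > 0"
  shows "urn_mart s \<le> e * sqrt (urn_mart s) ^ 3 + 1 / e * urn_size s"
proof -
  define v where "v = sqrt (urn_mart s)"
  have v: "v \<ge> 0" "urn_mart s = v\<^sup>2"
    by (simp_all add: v_def urn_mart_nonneg)
  have size: "0 \<le> urn_size s" by (simp add: urn_size_def split_beta)
  have "v\<^sup>2 \<le> (2 * urn_size s)\<^sup>2"
  proof -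
    have "(2 * urn_size s)\<^sup>2 = 4 * (urn_size s)\<^sup>2"
      by (simp add: power_mult_distrib)
    then show ?thesis
      using urn_mart_le[of s] zero_le_power2[of "urn_size s"] unfolding v(2) by linarith
  qed
  then have "v \<le> 2 * urn_size s"
    by (rule power2_le_imp_le) (use size in simp)
  \<comment> \<open>Weighted AM-GM inequality for \<open>v^3\<close> and \<open>v\<close>, written
    as a nonnegative square times \<open>v\<close>.\<close>
  moreover have "0 \<le> v * (e * v - 1)\<^sup>2" using v by simp
  then have "2 * e * v\<^sup>2 \<le> e * (e * v ^ 3) * 1 + v"
    by (simp add: power2_eq_square power3_eq_cube algebra_simps)
  moreover have "0 \<le> e * (e * v ^ 3)" using v assms by simp
  ultimately have "e * v\<^sup>2 \<le> e * (e * v ^ 3) + urn_size s"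
    by linarith
  then show ?thesis
    using assms v(1) unfolding v_def[symmetric] v(2) by (simp add: field_simps)
qed

theorem theorem2p10:
  fixes M :: "'a measure" and z0 :: nat and Z :: "nat \<Rightarrow> 'a \<Rightarrow> int \<times> int"
  assumes "prob_space M"
    and "z0 \<ge> 1"
    and "noisy_urn M z0 Z"
  shows "(\<integral>\<^sup>+ \<omega>. urn_area Z \<omega> \<partial>M) = \<infinity>"
proof (rule ccontr)
  assume fin: "(\<integral>\<^sup>+ \<omega>. urn_area Z \<omega> \<partial>M) \<noteq> \<infinity>"
  have mc: "markov_chain M (- {(0, 0)}) noisy_urn_step (int z0, 1) Z"
    using assms(3) by (simp add: noisy_urn_def)
  then have meas: "Z n \<in> measurable M (count_space (- {(0, 0)}))" for n
    by (simp add: markov_chain_def)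
  note meas' = markov_chain_measurable[OF mc]
  have start: "(int z0, 1) \<notin> urn_target"
    using assms(2) by (simp add: urn_target_def)
  define E where "E n h = killed_expectation M Z urn_target n (\<lambda>s. ennreal (h s))" for n h
  define cub where "cub s = sqrt (urn_mart s) ^ 3" for s
  have E_size: "E k urn_size \<le> 4 * killed_expectation M Z urn_target k
      (\<lambda>s. \<integral>\<^sup>+t. ennreal (step_area s t) \<partial>noisy_urn_step s)" for k
  proof -
    \<comment> \<open>The summand \<open>0 * 0\<close> only gives the integrand the shape of a
      linear combination of two functions.\<close>
    have "E k urn_size \<le> killed_expectation M Z urn_target k
        (\<lambda>s. 4 * (\<integral>\<^sup>+t. ennreal (step_area s t) \<partial>noisy_urn_step s) + 0 * 0)"
      unfolding E_def
      by (rule killed_expectation_mono[OF meas]) (simp add: step_area_mean_ge urn_size_ge_2)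
    then show ?thesis
      unfolding killed_expectation_linear[OF meas'] by simp
  qed
  \<comment> \<open>This is the expected sum of the sizes before \<open>\<tau>\<close>, finite
    because the expected area is assumed finite.\<close>
  define B where "B = (\<Sum>k. E k urn_size)"
  have "B \<le> (\<Sum>k. 4 * killed_expectation M Z urn_target k
      (\<lambda>s. \<integral>\<^sup>+t. ennreal (step_area s t) \<partial>noisy_urn_step s))"
    unfolding B_def by (intro suminf_le E_size) auto
  also have "\<dots> = 4 * (\<integral>\<^sup>+ \<omega>. urn_area Z \<omega> \<partial>M)"
    unfolding nn_integral_urn_area[OF assms(1,3)] by (rule ennreal_suminf_cmult)
  also have "\<dots> < \<top>"
    using fin by (simp add: ennreal_mult_less_top top.not_eq_extremum)
  finally have B: "B < \<top>" .
  \<comment> \<open>Every series converges in the extended nonnegative reals, so the terms pass to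
    the reals, where summability forces them to 0.\<close>
  have size_lim: "(\<lambda>n. E n urn_size) \<longlonglongrightarrow> 0"
  proof -
    have "E n urn_size < \<top>" for n
    proof -
      have "E n urn_size = (\<Sum>k\<in>{n}. E k urn_size)" by simp
      also have "\<dots> \<le> B" unfolding B_def by (rule sum_le_suminf) auto
      finally show ?thesis using B by simp
    qed
    then have eq: "E n urn_size = ennreal (enn2real (E n urn_size))" for n
      by simp
    have "summable (\<lambda>n. enn2real (E n urn_size))"
      using B unfolding B_def
      by (subst (asm) eq) (rule summable_suminf_not_top, auto)
    then have "(\<lambda>n. enn2real (E n urn_size)) \<longlonglongrightarrow> 0"
      by (rule summable_LIMSEQ_zero)
    then have "(\<lambda>n. ennreal (enn2real (E n urn_size))) \<longlonglongrightarrow> ennreal 0"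
      by (rule tendsto_ennrealI)
    then show ?thesis by (simp flip: eq)
  qed
  \<comment> \<open>No mass is lost at the target, because \<open>urn_mart\<close> vanishes
    there.\<close>
  have mart: "E n urn_mart = ennreal (urn_mart (int z0, 1))" for n
  proof (induction n)
    case 0
    show ?case unfolding E_def by (rule killed_expectation_0[OF assms(1) mc start])
  next
    case (Suc n)
    have "E (Suc n) urn_mart = killed_expectation M Z urn_target n
        (\<lambda>s. \<integral>\<^sup>+t. ennreal (urn_mart t) \<partial>noisy_urn_step s)"
      unfolding E_def by (rule killed_expectation_Suc[OF assms(1) mc]) (simp add: urn_mart_target)
    also have "\<dots> = E n urn_mart"
      unfolding E_def
      by (rule killed_expectation_cong[OF meas]) (simp add: urn_mart_harmonic urn_size_ge_2)
    finally show ?case using Suc by simp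
  qed
  \<comment> \<open>Summing the one-step drift bounds gives an estimate that stays bounded in
    \<open>n\<close> once \<open>B\<close> is finite.\<close>
  have cub_sum: "E n cub \<le> ennreal (cub (int z0, 1)) + 4 * (\<Sum>k<n. E k urn_size)" for n
  proof (induction n)
    case 0
    show ?case unfolding E_def by (simp add: killed_expectation_0[OF assms(1) mc start])
  next
    case (Suc n)
    have "E (Suc n) cub = killed_expectation M Z urn_target n
        (\<lambda>s. \<integral>\<^sup>+t. ennreal (cub t) \<partial>noisy_urn_step s)"
      unfolding E_def
      by (rule killed_expectation_Suc[OF assms(1) mc]) (simp add: urn_mart_target cub_def)
    also have "\<dots> \<le> killed_expectation M Z urn_target n
        (\<lambda>s. 1 * ennreal (cub s) + 4 * ennreal (urn_size s))"
      by (rule killed_expectation_mono[OF meas])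
         (simp add: urn_mart_sqrt_cube_drift urn_size_ge_2 cub_def)
    also have "\<dots> = E n cub + 4 * E n urn_size"
      unfolding killed_expectation_linear[OF meas'] E_def by simp
    also have "\<dots> \<le> ennreal (cub (int z0, 1)) + 4 * (\<Sum>k<n. E k urn_size) + 4 * E n urn_size"
      by (intro add_right_mono Suc)
    finally show ?case by (simp add: algebra_simps)
  qed
  define C where "C = enn2real (ennreal (cub (int z0, 1)) + 4 * B)"
  have C: "E n cub \<le> ennreal C" for n
  proof -
    have "(\<Sum>k<n. E k urn_size) \<le> B"
      unfolding B_def by (rule sum_le_suminf) auto
    then have "E n cub \<le> ennreal (cub (int z0, 1)) + 4 * B"
      using cub_sum[of n] by (meson add_left_mono mult_left_mono order_trans zero_le)
    also have "\<dots> = ennreal C"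
      unfolding C_def using B by (subst ennreal_enn2real) (auto simp: ennreal_mult_less_top)
    finally show ?thesis .
  qed
  have C0: "C \<ge> 0" by (simp add: C_def)
  define m where "m = urn_mart (int z0, 1)"
  \<comment> \<open>The start has two positive coordinates, so the lower bound for that quadrant
    applies.\<close>
  have m: "m > 0"
  proof -
    have "m \<ge> (real_of_int (int z0))\<^sup>2"
      unfolding m_def by (rule urn_mart_pos_quadrant(3)) (use assms(2) in simp)
    moreover have "(real_of_int (int z0))\<^sup>2 > 0"
      using assms(2) by simp
    ultimately show ?thesis by linarith
  qed
  \<comment> \<open>This makes \<open>e * C\<close> at most \<open>m / 2\<close>; the added 1 keeps
    the denominator positive when \<open>C = 0\<close>.\<close>
  define e where "e = m / (2 * (C + 1))"
  have e: "e > 0" "e * C < m"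
    using m C0 by (auto simp: e_def field_simps add_nonneg_pos)
  have "ennreal m \<le> ennreal (e * C) + ennreal (1 / e) * E n urn_size" for n
  proof -
    have "ennreal m = E n urn_mart" by (simp add: mart m_def)
    also have "\<dots> \<le> killed_expectation M Z urn_target n
        (\<lambda>s. ennreal e * ennreal (cub s) + ennreal (1 / e) * ennreal (urn_size s))"
      unfolding E_def
    proof (rule killed_expectation_mono[OF meas])
      fix s assume s: "s \<in> - {(0, 0)} - urn_target"
      have "ennreal (urn_mart s) \<le> ennreal (e * cub s + 1 / e * urn_size s)"
        unfolding cub_def by (intro ennreal_leI urn_mart_interpolation e)
      also have "\<dots> = ennreal e * ennreal (cub s) + ennreal (1 / e) * ennreal (urn_size s)"
        using e urn_size_ge_2[OF s] urn_mart_nonneg[of s]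
        by (subst ennreal_plus) (auto simp: cub_def ennreal_mult simp flip: ennreal_mult)
      finally show "ennreal (urn_mart s) \<le>
          ennreal e * ennreal (cub s) + ennreal (1 / e) * ennreal (urn_size s)" .
    qed
    also have "\<dots> = ennreal e * E n cub + ennreal (1 / e) * E n urn_size"
      unfolding killed_expectation_linear[OF meas'] E_def ..
    also have "\<dots> \<le> ennreal e * ennreal C + ennreal (1 / e) * E n urn_size"
      by (intro add_right_mono mult_left_mono C) simp
    finally show ?thesis using e C0 by (simp add: ennreal_mult)
  qed
  \<comment> \<open>With \<open>e\<close> fixed, the size term disappears in the limit. What
    remains, \<open>m \<le> e * C\<close>, contradicts the choice of \<open>e\<close>.\<close>
  moreover have "(\<lambda>n. ennreal (e * C) + ennreal (1 / e) * E n urn_size) \<longlonglongrightarrow> ennreal (e * C) + ennreal (1 / e) * 0"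
    by (intro tendsto_add tendsto_const ennreal_tendsto_cmult size_lim) simp
  ultimately have "ennreal m \<le> ennreal (e * C) + ennreal (1 / e) * 0"
    by (intro LIMSEQ_le_const) auto
  then have "m \<le> e * C"
    using e C0 by simp
  with e show False by simp
qed

end
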